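(* For every integer $n\ge 1$, let $L(n)$ be the order of the class of the all-ones vector $\mathbf 1\in\mathbb Z^{n^2}$ in the sandpile group $K_n=\mathbb Z^{n^2}/A_n\mathbb Z^{n^2}$ of the wired $n\times n$ square. Then \[ \nu_2(L(n))= \begin{cases} 2,& n=1,\\ 1,& n\ge 2\text{ even},\\ \nu_2(n+1)+2,& n\ge 3\text{ odd}. \end{cases} \]
   Context: For $n\ge1$, $D_n$ is the $n\times n$ integer tridiagonal matrix with all diagonal entries equal to $2$ and all entries on the first sub- and superdiagonal equal to $-1$ (so $D_1=(2)$). The reduced Laplacian of the wired $n\times n$ square (the $n\times n$ grid of nonsink vertices whose boundary is wired to one sink) is the $n^2\times n^2$ integer matrix \[ A_n=D_n\otimes I_n+I_n\otimes D_n , \] where $\otimes$ is the Kronecker product. It is positive definite, hence invertible over $\mathbb Q$. Equivalently to the definition in the claim, $L(n)$ is the least positive integer $q$ such that $qA_n^{-1}\mathbf 1\in\mathbb Z^{n^2}$. For a nonzero rational number $x$, $\nu_2(x)$ denotes the exponent of $2$ in $x$. *)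

theory Defs
  imports
    "Jordan_Normal_Form.Matrix"
    "HOL-Algebra.Multiplicative_Group"
    "HOL-Computational_Algebra.Primes"
begin

text \<open>Rows and columns are indexed from 0; the pair of indices \<open>(i, k)\<close> of a Kronecker
  product, with \<open>k\<close> below the dimension \<open>r\<close> of the second factor, is encoded as \<open>i * r + k\<close>.\<close>

definition kronecker_mat :: "'a :: semiring_0 mat \<Rightarrow> 'a mat \<Rightarrow> 'a mat" where
  "kronecker_mat A B =
     mat (dim_row A * dim_row B) (dim_col A * dim_col B)
       (\<lambda>(i, j). A $$ (i div dim_row B, j div dim_col B) * B $$ (i mod dim_row B, j mod dim_col B))"

definition D_mat :: "nat \<Rightarrow> int mat" where
  "D_mat n = mat n n (\<lambda>(i, j). if i = j then 2 else if i = j + 1 \<or> j = i + 1 then -1 else 0)"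

definition reduced_laplacian :: "nat \<Rightarrow> int mat" where
  "reduced_laplacian n = kronecker_mat (D_mat n) (1\<^sub>m n) + kronecker_mat (1\<^sub>m n) (D_mat n)"

text \<open>The record \<open>monoid_vec\<close> is the additive group of vectors, written multiplicatively.\<close>

definition laplacian_image :: "nat \<Rightarrow> int vec set" where
  "laplacian_image n = (\<lambda>x. reduced_laplacian n *\<^sub>v x) ` carrier_vec (n\<^sup>2)"

definition sandpile_group :: "nat \<Rightarrow> int vec set monoid" where
  "sandpile_group n = monoid_vec TYPE(int) (n\<^sup>2) Mod laplacian_image n"

definition sandpile_class :: "nat \<Rightarrow> int vec \<Rightarrow> int vec set" where
  "sandpile_class n v = laplacian_image n #>\<^bsub>monoid_vec TYPE(int) (n\<^sup>2)\<^esub> v"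

definition ones_vec :: "nat \<Rightarrow> int vec" where
  "ones_vec m = vec m (\<lambda>_. 1)"

definition L :: "nat \<Rightarrow> nat" where
  "L n = group.ord (sandpile_group n) (sandpile_class n (ones_vec (n\<^sup>2)))"

lemma reduced_laplacian_carrier: "reduced_laplacian n \<in> carrier_mat (n\<^sup>2) (n\<^sup>2)"
  by (rule carrier_matI)
    (simp_all add: reduced_laplacian_def kronecker_mat_def D_mat_def power2_eq_square)

lemma comm_group_sandpile_group: "comm_group (sandpile_group n)"
proof -
  let ?G = "monoid_vec TYPE(int) (n\<^sup>2)"
  let ?A = "reduced_laplacian n"
  interpret G: comm_group ?G by (rule comm_group_vec)
  have "(\<lambda>x. ?A *\<^sub>v x) \<in> hom ?G ?G"
    by (rule homI)
      (simp_all only: monoid_vec_simps mult_mat_vec_carrier[OF reduced_laplacian_carrier]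
        mult_add_distrib_mat_vec[OF reduced_laplacian_carrier])
  then interpret h: group_hom ?G ?G "\<lambda>x. ?A *\<^sub>v x"
    by (intro group_hom.intro group_hom_axioms.intro G.group_axioms)
  have "subgroup (laplacian_image n) ?G"
    using h.img_is_subgroup by (simp only: laplacian_image_def monoid_vec_simps)
  then show ?thesis
    unfolding sandpile_group_def by (rule G.abelian_FactGroup)
qed

lemma sandpile_class_carrier:
  "v \<in> carrier_vec (n\<^sup>2) \<Longrightarrow> sandpile_class n v \<in> carrier (sandpile_group n)"
  by (simp add: sandpile_class_def sandpile_group_def carrier_FactGroup monoid_vec_simps)

end

theory Submission
  imports
    Defs
    "Jordan_Normal_Form.Char_Poly"
    "HOL-Computational_Algebra.Fundamental_Theorem_Algebra"
begin

text \<open>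
  Write \<open>T\<close> for the adjacency matrix of the path with \<open>n\<close> vertices, so that \<open>D\<^sub>n = 2 - T\<close>. Its
  characteristic polynomial is the Chebyshev polynomial \<open>p = S\<^sub>n\<^sub>+\<^sub>1\<close>, where
  \<open>S\<^sub>k(2 cos \<theta>) = sin (k\<theta>) / sin \<theta>\<close>, and the first unit vector generates \<open>\<int>\<^sup>n\<close> under \<open>T\<close>, with \<open>S\<^sub>k(T)\<close>
  sending it to the \<open>k\<close>-th unit vector. Thus the grid functions form the ring \<open>\<int>[x, y] / (p(x), p(y))\<close>, the
  Laplacian is multiplication by \<open>4 - x - y\<close>, and the sandpile group is \<open>\<int>[x] / (p(x), p(4 - x))\<close>. The all-ones
  vector is \<open>g(x) g(4 - x)\<close> with \<open>g = S\<^sub>1 + \<dots> + S\<^sub>n\<close>. For the multiples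
  of the all-ones vector this dictionary is made precise by \<open>L_dvd_iff\<close>, \<open>constant_in_laplacian_image_iff\<close>,
  \<open>grid_solution_imp_mirror_ideal\<close> and \<open>mirror_ideal_imp_grid_solution\<close>.

  Half-angle formulas give \<open>p = P F\<close> and \<open>g = P h\<close> with \<open>h\<close> a unit modulo \<open>F\<close>: for \<open>n = 2m - 1\<close> one has
  \<open>F = C\<^sub>m\<close>, where \<open>C\<^sub>m(2 cos \<theta>) = 2 cos (m\<theta>)\<close>, and for \<open>n = 2d\<close> one has \<open>F = S\<^sub>d\<^sub>+\<^sub>1 - S\<^sub>d\<close>. As \<open>p(x)\<close> and \<open>p(4 - x)\<close>
  have no common complex root, \<open>P\<close> can be cancelled, and \<open>L(n)\<close> is the least positive integer in the ideal
  \<open>(F(x), F(4 - x))\<close> (\<open>L_dvd_iff_mirror_ideal\<close>).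

  The exponent of 2 is then read off from \<open>F(4 - x)\<close> modulo \<open>F(x)\<close>. For even \<open>n\<close> it is twice a unit, up to a
  multiple of 4 (\<open>even_grid_upper\<close>, \<open>even_grid_lower\<close>). For odd \<open>n\<close>, let \<open>m = 2\<^sup>a k\<close> with \<open>k\<close> odd. To first order,
  \<open>C\<^sub>m(4 - x)\<close> is \<open>\<plusminus> (C\<^sub>m - 4 m S\<^sub>m)\<close>, as \<open>m S\<^sub>m\<close> is the derivative of \<open>C\<^sub>m\<close>; more precisely it is congruent to
  \<open>2\<^sup>a\<^sup>+\<^sup>2 S\<^sub>m\<close> times a 2-adic unit modulo \<open>C\<^sub>m\<close> (\<open>mirror_cheb_C_dyadic\<close>, and \<open>odd_grid_upper\<close> for the unit). Finally \<open>S\<^sub>m\<close> divides 2 modulo \<open>C\<^sub>m\<close>, but is not a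
  unit modulo 2 unless \<open>m = 1\<close>. This gives the exponent \<open>a + 3\<close> for \<open>m \<ge> 2\<close> (\<open>odd_grid_upper\<close>,
  \<open>odd_grid_lower\<close>), while \<open>m = 1\<close> is the ideal \<open>(x, 4 - x) = (x, 4)\<close>.
\<close>

section \<open>Chebyshev polynomials\<close>

definition X :: "int poly" where
  "X = [:0, 1:]"

text \<open>
  Chebyshev polynomials in the monic normalisation: with \<open>X = 2 cos \<theta>\<close>, \<open>cheb_S k = sin (k\<theta>) / sin \<theta>\<close>
  and \<open>cheb_C m = 2 cos (m\<theta>)\<close>. They enter because \<open>cheb_S (n + 1)\<close> is the characteristic polynomial of the
  adjacency matrix of the path with \<open>n\<close> vertices. The identities below are those of trigonometry,
  derived from the recurrence and the Pythagorean relation \<open>cheb_S_norm\<close>.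
\<close>

fun cheb_S :: "nat \<Rightarrow> int poly" where
  "cheb_S 0 = 0"
| "cheb_S (Suc 0) = 1"
| "cheb_S (Suc (Suc k)) = X * cheb_S (Suc k) - cheb_S k"

definition cheb_C :: "nat \<Rightarrow> int poly" where
  "cheb_C m = 2 * cheb_S (Suc m) - X * cheb_S m"

text \<open>
  On the grid the two path adjacency operators \<open>x\<close> and \<open>y\<close> are tied by \<open>x + y = 4\<close> modulo the image of
  the Laplacian, so that polynomials in \<open>y\<close> become polynomials in \<open>4 - x\<close>.
\<close>

definition mirror :: "int poly \<Rightarrow> int poly" where
  "mirror f = f \<circ>\<^sub>p [:4, -1:]"

lemma mirror_simps [simp]:
  "mirror 0 = 0" "mirror 1 = 1" "mirror (numeral k) = numeral k" "mirror (of_int r) = of_int r"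
  "mirror (f + g) = mirror f + mirror g" "mirror (f - g) = mirror f - mirror g" "mirror (- f) = - mirror f"
  "mirror (f * g) = mirror f * mirror g" "mirror (f ^ i) = mirror f ^ i" "mirror X = 4 - X"
  "mirror (sum h J) = (\<Sum>j\<in>J. mirror (h j))"
proof -
  show c: "mirror (of_int r) = of_int r" for r
    by (simp add: mirror_def of_int_poly)
  show "mirror (numeral k) = numeral k" using c[of "numeral k"] by simp
  show "mirror 1 = 1" using c[of 1] by simp
  show m: "mirror (f * g) = mirror f * mirror g" for f g by (simp add: mirror_def pcompose_mult)
  show "mirror (f ^ i) = mirror f ^ i" using \<open>mirror 1 = 1\<close> by (induction i) (simp_all add: m)
  show "mirror X = 4 - X"
    by (simp add: mirror_def X_def pcompose_pCons numeral_poly)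
qed (simp_all add: mirror_def pcompose_add pcompose_diff pcompose_uminus pcompose_sum)

lemma mirror_mirror [simp]: "mirror (mirror f) = f"
proof -
  have "[:4, -1:] \<circ>\<^sub>p [:4, -1:] = ([:0, 1:] :: int poly)" by (simp add: pcompose_pCons)
  then show ?thesis by (simp add: mirror_def flip: pcompose_assoc)
qed

lemma poly_mirror: "poly (map_poly of_int (mirror f)) (z :: 'a :: comm_ring_1) = poly (map_poly of_int f) (4 - z)"
proof -
  have "map_poly of_int (mirror f) = map_poly (of_int :: int \<Rightarrow> 'a) f \<circ>\<^sub>p map_poly of_int [:4, -1:]"
    unfolding mirror_def by (rule of_int_hom.map_poly_pcompose)
  then show ?thesis by (simp add: poly_pcompose)
qed

lemma cheb_S_add: "cheb_S (Suc (i + j)) = cheb_S (Suc i) * cheb_S (Suc j) - cheb_S i * cheb_S j"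
proof (induction j rule: cheb_S.induct)
  case (3 k)
  have "cheb_S (Suc (i + Suc (Suc k))) = X * cheb_S (Suc (i + Suc k)) - cheb_S (Suc (i + k))" by simp
  then show ?case unfolding 3 by (simp add: algebra_simps)
qed simp_all

lemma cheb_S_norm: "cheb_S (Suc k) ^ 2 + cheb_S k ^ 2 - X * cheb_S k * cheb_S (Suc k) = 1"
proof (induction k)
  case (Suc k)
  have "cheb_S (Suc (Suc k)) ^ 2 + cheb_S (Suc k) ^ 2 - X * cheb_S (Suc k) * cheb_S (Suc (Suc k))
      = cheb_S (Suc k) ^ 2 + cheb_S k ^ 2 - X * cheb_S k * cheb_S (Suc k)"
    by (simp add: algebra_simps power2_eq_square)
  then show ?case using Suc by simp
qed simp

lemma cheb_C_simps:
  "cheb_C 0 = 2" "cheb_C (Suc 0) = X"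
  "cheb_C (Suc (Suc k)) = X * cheb_C (Suc k) - cheb_C k"
  by (simp_all add: cheb_C_def algebra_simps)

lemma cheb_C_Suc: "cheb_C (Suc k) = cheb_S (Suc (Suc k)) - cheb_S k"
  by (simp add: cheb_C_def algebra_simps)

lemma cheb_S_double: "cheb_S (2 * m) = cheb_S m * cheb_C m"
proof (cases m)
  case (Suc k)
  have "cheb_S (2 * m) = cheb_S (Suc (m + k))" using Suc by (simp add: mult_2)
  also have "\<dots> = cheb_S m * cheb_C m"
    unfolding cheb_S_add by (simp add: Suc cheb_C_def algebra_simps)
  finally show ?thesis .
qed simp

lemma cheb_S_double_plus_1: "cheb_S (Suc (2 * d)) = (cheb_S (Suc d) + cheb_S d) * (cheb_S (Suc d) - cheb_S d)"
  unfolding mult_2 cheb_S_add by (simp add: algebra_simps)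

lemma cheb_C_pell: "cheb_C m ^ 2 = 4 + (X ^ 2 - 4) * cheb_S m ^ 2"
  using cheb_S_norm[of m] unfolding cheb_C_def by Groebner_Basis.algebra

lemma cheb_C_double: "cheb_C (2 * m) = cheb_C m ^ 2 - 2"
proof -
  have "cheb_C (2 * m) = 2 * (cheb_S (Suc m) ^ 2 - cheb_S m ^ 2) - X * (cheb_S m * cheb_C m)"
    unfolding cheb_C_def[of "2 * m"] cheb_S_double cheb_S_double_plus_1 by Groebner_Basis.algebra
  then show ?thesis using cheb_S_norm[of m] unfolding cheb_C_def by Groebner_Basis.algebra
qed

lemma sum_cheb_S_double_plus_1: "(\<Sum>k=1..Suc (2 * d). cheb_S k) = cheb_S (Suc d) * (cheb_S (Suc d) + cheb_S d)"
  and sum_cheb_S_double: "(\<Sum>k=1..2 * d. cheb_S k) = cheb_S d * (cheb_S (Suc d) + cheb_S d)"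
proof -
  have "(\<Sum>k=1..2 * d. cheb_S k) = cheb_S d * (cheb_S (Suc d) + cheb_S d) \<and>
    (\<Sum>k=1..Suc (2 * d). cheb_S k) = cheb_S (Suc d) * (cheb_S (Suc d) + cheb_S d)"
  proof (induction d)
    case (Suc d)
    have e: "(\<Sum>k=1..2 * Suc d. cheb_S k) = cheb_S (Suc d) * (cheb_S (Suc (Suc d)) + cheb_S (Suc d))"
      using Suc cheb_S_double[of "Suc d"] by (simp add: cheb_C_Suc algebra_simps)
    then have "(\<Sum>k=1..Suc (2 * Suc d). cheb_S k) =
        cheb_S (Suc d) * (cheb_S (Suc (Suc d)) + cheb_S (Suc d)) + cheb_S (Suc (2 * Suc d))" by simp
    then show ?case using e unfolding cheb_S_double_plus_1 by (simp del: cheb_S.simps add: algebra_simps)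
  qed simp_all
  then show "(\<Sum>k=1..Suc (2 * d). cheb_S k) = cheb_S (Suc d) * (cheb_S (Suc d) + cheb_S d)"
    "(\<Sum>k=1..2 * d. cheb_S k) = cheb_S d * (cheb_S (Suc d) + cheb_S d)" by auto
qed

lemma cheb_S_monic: "degree (cheb_S (Suc k)) = k" "lead_coeff (cheb_S (Suc k)) = 1"
proof -
  have "degree (cheb_S (Suc k)) = k \<and> coeff (cheb_S (Suc k)) k = 1 \<and> degree (cheb_S k) \<le> k - 1"
  proof (induction k)
    case (Suc k)
    then have d: "degree (X * cheb_S (Suc k)) = Suc k" and c: "coeff (X * cheb_S (Suc k)) (Suc k) = 1"
      by (auto simp: X_def degree_mult_eq)
    have k: "degree (cheb_S k) < Suc k" using Suc by auto
    then have "degree (X * cheb_S (Suc k) + - cheb_S k) = Suc k"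
      using d by (subst degree_add_eq_left) auto
    then show ?case using Suc c k by (simp add: coeff_eq_0)
  qed auto
  then show "degree (cheb_S (Suc k)) = k" "lead_coeff (cheb_S (Suc k)) = 1" by auto
qed

lemma cheb_S_diff_monic:
  "degree (cheb_S (Suc d) - cheb_S d) = d" "lead_coeff (cheb_S (Suc d) - cheb_S d) = 1"
  "lead_coeff (cheb_S (Suc d) + cheb_S d) = 1"
proof -
  have "degree (cheb_S (Suc d) - cheb_S d) = d \<and> coeff (cheb_S (Suc d) - cheb_S d) d = 1 \<and>
    degree (cheb_S (Suc d) + cheb_S d) = d \<and> coeff (cheb_S (Suc d) + cheb_S d) d = 1"
  proof (cases d)
    case (Suc e)
    have "degree (cheb_S d) < degree (cheb_S (Suc d))" unfolding Suc using cheb_S_monic(1) by (metis lessI)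
    then show ?thesis using cheb_S_monic[of d] degree_add_eq_left[of "- cheb_S d" "cheb_S (Suc d)"]
        degree_add_eq_left[of "cheb_S d" "cheb_S (Suc d)"]
      by (simp add: coeff_eq_0)
  qed auto
  then show "degree (cheb_S (Suc d) - cheb_S d) = d" "lead_coeff (cheb_S (Suc d) - cheb_S d) = 1"
    "lead_coeff (cheb_S (Suc d) + cheb_S d) = 1" by auto
qed

lemma cheb_C_monic: "degree (cheb_C (Suc k)) = Suc k" "lead_coeff (cheb_C (Suc k)) = 1"
proof -
  have "degree (cheb_C (Suc k)) = Suc k \<and> coeff (cheb_C (Suc k)) (Suc k) = 1"
  proof (cases k)
    case 0
    then show ?thesis by (simp add: cheb_C_simps X_def)
  next
    case (Suc e)
    have "degree (cheb_S k) < degree (cheb_S (Suc (Suc k)))"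
      unfolding Suc using cheb_S_monic(1) by (metis lessI less_SucI)
    then show ?thesis
      using cheb_S_monic[of "Suc k"] degree_add_eq_left[of "- cheb_S k" "cheb_S (Suc (Suc k))"]
      by (simp add: cheb_C_Suc coeff_eq_0 del: cheb_S.simps)
  qed
  then show "degree (cheb_C (Suc k)) = Suc k" "lead_coeff (cheb_C (Suc k)) = 1" by auto
qed

section \<open>Reflected Chebyshev polynomials modulo powers of 2\<close>

text \<open>
  Modulo 4 the reflection is \<open>X \<mapsto> - X\<close>, and \<open>cheb_S (k + 1)\<close> is an even or odd function according to the
  parity of \<open>k\<close>.
\<close>

lemma mirror_cheb_S_mod: "\<exists>G. mirror (cheb_S (Suc k)) = (- 1) ^ k * cheb_S (Suc k) + 4 * G"
proof -
  have "(\<exists>G. mirror (cheb_S (Suc k)) = (- 1) ^ k * cheb_S (Suc k) + 4 * G) \<and>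
     (\<exists>G. mirror (cheb_S k) = - ((- 1) ^ k * cheb_S k) + 4 * G)"
  proof (induction k)
    case 0
    show ?case by (auto intro: exI[of _ 0])
  next
    case (Suc k)
    then obtain G H where G: "mirror (cheb_S (Suc k)) = (- 1) ^ k * cheb_S (Suc k) + 4 * G"
      and H: "mirror (cheb_S k) = - ((- 1) ^ k * cheb_S k) + 4 * H" by blast
    have "mirror (cheb_S (Suc (Suc k))) = (4 - X) * mirror (cheb_S (Suc k)) - mirror (cheb_S k)" by simp
    also have "\<dots> = (- 1) ^ Suc k * cheb_S (Suc (Suc k))
        + 4 * ((- 1) ^ k * cheb_S (Suc k) + (4 - X) * G - H)"
      unfolding G H by (simp add: algebra_simps)
    finally have "\<exists>G. mirror (cheb_S (Suc (Suc k))) = (- 1) ^ Suc k * cheb_S (Suc (Suc k)) + 4 * G" ..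
    moreover have "mirror (cheb_S (Suc k)) = - ((- 1) ^ Suc k * cheb_S (Suc k)) + 4 * G" using G by simp
    ultimately show ?case by blast
  qed
  then show ?thesis ..
qed

text \<open>
  Modulo 4 the reflection is \<open>\<theta> \<mapsto> \<pi> - \<theta>\<close>, which exchanges \<open>sin\<close> and \<open>cos\<close> of the half angle, hence, up to
  sign, the difference and the sum of two neighbouring polynomials. The sum is written as the difference
  plus \<open>2 * cheb_S d\<close> because it is wanted modulo the difference.
\<close>

lemma mirror_cheb_S_diff_mod:
  "\<exists>G. mirror (cheb_S (Suc d) - cheb_S d) = (- 1) ^ d * ((cheb_S (Suc d) - cheb_S d) + 2 * cheb_S d) + 4 * G"
proof (cases d)
  case 0
  then show ?thesis by (auto intro: exI[of _ 0])
next
  case (Suc e)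
  obtain G where G: "mirror (cheb_S (Suc d)) = (- 1) ^ d * cheb_S (Suc d) + 4 * G"
    using mirror_cheb_S_mod by blast
  obtain H where H: "mirror (cheb_S d) = (- 1) ^ e * cheb_S d + 4 * H"
    using mirror_cheb_S_mod unfolding Suc by blast
  have "mirror (cheb_S (Suc d) - cheb_S d) = mirror (cheb_S (Suc d)) - mirror (cheb_S d)" by simp
  also have "\<dots> = (- 1) ^ d * ((cheb_S (Suc d) - cheb_S d) + 2 * cheb_S d) + 4 * (G - H)"
    unfolding G H by (simp add: Suc algebra_simps)
  finally show ?thesis ..
qed

text \<open>
  Taylor expansion of \<open>cheb_C k\<close> around \<open>- X\<close> with increment 4: the derivative of \<open>cheb_C k\<close> is
  \<open>k * cheb_S k\<close>, and the higher terms are divisible by 16.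
\<close>

lemma mirror_cheb_C_mod: "\<exists>G. mirror (cheb_C k) = (- 1) ^ k * (cheb_C k - 4 * of_nat k * cheb_S k) + 16 * G"
proof -
  have "(\<exists>G. mirror (cheb_C k) = (- 1) ^ k * (cheb_C k - 4 * of_nat k * cheb_S k) + 16 * G) \<and>
    (\<exists>G. mirror (cheb_C (Suc k)) = (- 1) ^ Suc k * (cheb_C (Suc k) - 4 * of_nat (Suc k) * cheb_S (Suc k)) + 16 * G)"
  proof (induction k)
    case 0
    show ?case by (auto simp: cheb_C_simps intro: exI[of _ 0])
  next
    case (Suc k)
    then obtain G H
      where G: "mirror (cheb_C k) = (- 1) ^ k * (cheb_C k - 4 * of_nat k * cheb_S k) + 16 * G"
      and H: "mirror (cheb_C (Suc k)) = (- 1) ^ Suc k * (cheb_C (Suc k) - 4 * of_nat (Suc k) * cheb_S (Suc k)) + 16 * H"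
      by blast
    have "mirror (cheb_C (Suc (Suc k))) = (4 - X) * mirror (cheb_C (Suc k)) - mirror (cheb_C k)"
      by (simp add: cheb_C_simps)
    also have "\<dots> = (- 1) ^ Suc (Suc k) * (cheb_C (Suc (Suc k)) - 4 * of_nat (Suc (Suc k)) * cheb_S (Suc (Suc k)))
       + 16 * ((- 1) ^ k * of_nat (Suc k) * cheb_S (Suc k) + (4 - X) * H - G)"
      unfolding G H unfolding cheb_C_def by (simp add: algebra_simps)
    finally show ?case using Suc by blast
  qed
  then show ?thesis ..
qed

text \<open>
  Refinement of the previous expansion for an index \<open>m = 2\<^sup>a k\<close>: the correction is divisible by \<open>2\<^sup>a\<^sup>+\<^sup>2\<close>, and
  the quotient is known modulo 4. It is obtained from \<open>a = 0\<close> by doubling the index, since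
  \<open>cheb_C (2m) = (cheb_C m)\<^sup>2 - 2\<close> turns the reflection \<open>s c + 2\<^sup>a\<^sup>+\<^sup>2 E\<close> of \<open>c = cheb_C m\<close> into
  \<open>cheb_C (2m) + 2\<^sup>a\<^sup>+\<^sup>3 E (s c + 2\<^sup>a\<^sup>+\<^sup>1 E)\<close>. The first doubling creates \<open>Z = (cheb_S m)\<^sup>2\<close>, later ones multiply \<open>Z\<close>
  by \<open>c\<close>. What matters
  about \<open>Z\<close> is only that \<open>X\<^sup>2 Z\<close> vanishes modulo 2 and \<open>cheb_C m\<close>: this makes \<open>Z\<close> harmless in
  \<open>odd_grid_upper\<close>. The sign \<open>s = - 1\<close> occurs for \<open>a = 0\<close>.
\<close>

lemma mirror_cheb_C_dyadic:
  assumes "odd k"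
  shows "\<exists>s u Z K. (s = 1 \<or> s = - 1) \<and> odd (u :: int) \<and>
    mirror (cheb_C (2 ^ a * k)) = s * cheb_C (2 ^ a * k)
      + 2 ^ (a + 2) * (of_int u * cheb_S (2 ^ a * k) + 2 * Z + 4 * K) \<and>
    (if a = 0 then Z = 0 else \<exists>W. X ^ 2 * Z = cheb_C (2 ^ a * k) + 2 * W)"
proof (induction a)
  case 0
  obtain G where "mirror (cheb_C k) = (- 1) ^ k * (cheb_C k - 4 * of_nat k * cheb_S k) + 16 * G"
    using mirror_cheb_C_mod by blast
  then show ?case using assms
    by (intro exI[of _ "- 1"] exI[of _ "int k"] exI[of _ 0] exI[of _ G]) (simp add: algebra_simps)
next
  case (Suc a)
  define m where "m = 2 ^ a * k"
  have m2: "2 ^ Suc a * k = 2 * m" by (simp add: m_def)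
  obtain s u Z K where s: "s = 1 \<or> s = - 1" and u: "odd u"
    and D: "mirror (cheb_C m) = s * cheb_C m + 2 ^ (a + 2) * (of_int u * cheb_S m + 2 * Z + 4 * K)"
    and Z: "if a = 0 then Z = 0 else \<exists>W. X ^ 2 * Z = cheb_C m + 2 * W"
    using Suc unfolding m_def by blast
  have s2: "s * s = 1" using s by auto
  have "\<exists>t. s = of_int t \<and> odd t" using s by (auto intro: exI[of _ 1] exI[of _ "- 1"])
  then obtain t where t: "s = of_int t" "odd t" by blast
  define E where "E = of_int u * cheb_S m + 2 * Z + 4 * K"
  have "mirror (cheb_C (2 * m)) = mirror (cheb_C m) ^ 2 - 2" by (simp add: cheb_C_double)
  also have "\<dots> = s * s * cheb_C m ^ 2 - 2 + 2 ^ (a + 3) * (s * cheb_C m * E + 2 * 2 ^ a * E ^ 2)"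
    unfolding D E_def[symmetric] power_add by Groebner_Basis.algebra
  finally have D2: "mirror (cheb_C (2 * m))
      = 1 * cheb_C (2 * m) + 2 ^ (Suc a + 2) * (s * cheb_C m * E + 2 * 2 ^ a * E ^ 2)"
    by (simp add: s2 cheb_C_double power_add)
  show ?case
  proof (cases "a = 0")
    case True
    with Z have "Z = 0" by simp
    obtain w where "u ^ 2 = 1 + 2 * w" using u by (metis add.commute even_power oddE)
    then have w: "of_int u ^ 2 = (1 + 2 * of_int w :: int poly)"
      by (metis of_int_1 of_int_add of_int_mult of_int_numeral of_int_power)
    have "E ^ 2 = of_int u ^ 2 * cheb_S m ^ 2 + 8 * (of_int u * cheb_S m * K + 2 * K ^ 2)"
      unfolding E_def \<open>Z = 0\<close> by (simp add: algebra_simps power2_eq_square)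
    then have "s * cheb_C m * E + 2 * 2 ^ a * E ^ 2 = of_int (t * u) * cheb_S (2 * m) + 2 * cheb_S m ^ 2
        + 4 * (s * cheb_C m * K + of_int w * cheb_S m ^ 2 + 4 * (of_int u * cheb_S m * K + 2 * K ^ 2))"
      unfolding E_def \<open>Z = 0\<close> w True t cheb_S_double by (simp add: algebra_simps)
    moreover have "X ^ 2 * cheb_S m ^ 2 = cheb_C (2 * m) + 2 * (2 * cheb_S m ^ 2 - 1)"
      using cheb_C_pell[of m] unfolding cheb_C_double by Groebner_Basis.algebra
    ultimately have "mirror (cheb_C (2 * m)) = 1 * cheb_C (2 * m) + 2 ^ (Suc a + 2) * (of_int (t * u) * cheb_S (2 * m)
        + 2 * cheb_S m ^ 2 + 4 * (s * cheb_C m * K + of_int w * cheb_S m ^ 2 + 4 * (of_int u * cheb_S m * K + 2 * K ^ 2)))"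
      "\<exists>W. X ^ 2 * cheb_S m ^ 2 = cheb_C (2 * m) + 2 * W"
      using D2 by metis+
    moreover have "odd (t * u)" using t u by simp
    ultimately show ?thesis
      unfolding m2 if_not_P[OF Suc_not_Zero] by metis
  next
    case False
    then obtain b where b: "a = Suc b" using not0_implies_Suc by auto
    obtain W where W: "X ^ 2 * Z = cheb_C m + 2 * W" using Z False by auto
    have "s * cheb_C m * E + 2 * 2 ^ a * E ^ 2 = of_int (t * u) * cheb_S (2 * m) + 2 * (s * cheb_C m * Z)
        + 4 * (s * cheb_C m * K + 2 ^ b * E ^ 2)"
      unfolding b cheb_S_double t by (simp add: E_def algebra_simps)
    moreover have "\<exists>W'. X ^ 2 * (s * cheb_C m * Z) = cheb_C (2 * m) + 2 * W'"
    proof -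
      have "X ^ 2 * (s * cheb_C m * Z) = s * cheb_C m * (cheb_C m + 2 * W)"
        unfolding W[symmetric] by (simp add: algebra_simps)
      also have "\<dots> = s * (cheb_C (2 * m) + 2) + 2 * s * cheb_C m * W"
        unfolding cheb_C_double by Groebner_Basis.algebra
      finally have e: "X ^ 2 * (s * cheb_C m * Z) = s * (cheb_C (2 * m) + 2) + 2 * s * cheb_C m * W" .
      from s show ?thesis
      proof
        assume "s = 1"
        then show ?thesis
          unfolding e by (intro exI[of _ "1 + cheb_C m * W"]) (simp add: algebra_simps)
      next
        assume "s = - 1"
        then show ?thesis
          unfolding e by (intro exI[of _ "- cheb_C (2 * m) - 1 - cheb_C m * W"]) (simp add: algebra_simps)
      qed
    qed
    moreover have "odd (t * u)" using t u by simp
    ultimately show ?thesis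
      using D2 unfolding m2 if_not_P[OF Suc_not_Zero] by metis
  qed
qed

section \<open>The order of 1 modulo a polynomial and its reflection\<close>

text \<open>
  The integers in \<open>mirror_ideal F\<close> are those that vanish in the ring \<open>\<int>[x] / (F(x), F(4 - x))\<close>; the
  additive order of the unit of that ring is what has to be computed.
\<close>

definition mirror_ideal :: "int poly \<Rightarrow> int poly set" where
  "mirror_ideal F = {F * A + mirror F * B | A B. True}"

lemma mirror_idealI: "p = F * A + mirror F * B \<Longrightarrow> p \<in> mirror_ideal F"
  by (auto simp: mirror_ideal_def)

lemma mirror_idealE:
  assumes "p \<in> mirror_ideal F"
  obtains A B where "p = F * A + mirror F * B"
  using assms by (auto simp: mirror_ideal_def)

lemma mirror_ideal_mult:
  assumes "p \<in> mirror_ideal F"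
  shows "p * r \<in> mirror_ideal F"
proof -
  obtain A B where "p = F * A + mirror F * B" using assms by (rule mirror_idealE)
  then have "p * r = F * (A * r) + mirror F * (B * r)" by (simp add: algebra_simps)
  then show ?thesis by (rule mirror_idealI)
qed

lemma mirror_ideal_diff:
  assumes "p \<in> mirror_ideal F" "q \<in> mirror_ideal F"
  shows "p - q \<in> mirror_ideal F"
proof -
  obtain A B where "p = F * A + mirror F * B" using assms(1) by (rule mirror_idealE)
  moreover obtain A' B' where "q = F * A' + mirror F * B'" using assms(2) by (rule mirror_idealE)
  ultimately have "p - q = F * (A - A') + mirror F * (B - B')" by (simp add: algebra_simps)
  then show ?thesis by (rule mirror_idealI)
qed

lemma monic_division:
  fixes F :: "int poly"
  assumes "lead_coeff F = 1"
  obtains Q R where "P = F * Q + R" "R = 0 \<or> degree R < degree F"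
proof -
  have "F \<noteq> 0" using assms by auto
  obtain Q R where "pseudo_divmod P F = (Q, R)" by fastforce
  from pseudo_divmod[OF \<open>F \<noteq> 0\<close> this] assms that show ?thesis by simp
qed

text \<open>
  Euclidean division by a monic polynomial works over the integers, so \<open>\<int>[x] / (F)\<close> is free as a
  \<open>\<int>\<close>-module and in particular torsion-free.
\<close>

lemma monic_cancel_scalar:
  fixes F :: "int poly"
  assumes F: "lead_coeff F = 1" and eq: "F * A = of_int c * B" and "c \<noteq> 0"
  obtains Q where "A = of_int c * Q" "B = F * Q"
proof -
  obtain Q R where B: "B = F * Q + R" and R: "R = 0 \<or> degree R < degree F"
    using monic_division[OF F] .
  have *: "F * (A - of_int c * Q) = of_int c * R" using eq unfolding B by (simp add: algebra_simps)
  have "A - of_int c * Q = 0"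
  proof (rule ccontr)
    assume ne: "A - of_int c * Q \<noteq> 0"
    have "F \<noteq> 0" using F by auto
    then have "of_int c * R \<noteq> 0" and "degree (of_int c * R) \<ge> degree F"
      unfolding *[symmetric] using ne by (auto simp: degree_mult_eq)
    with R \<open>c \<noteq> 0\<close> show False by (auto simp: of_int_poly)
  qed
  then have "A = of_int c * Q" by simp
  moreover have "B = F * Q" using * \<open>A - _ = 0\<close> \<open>c \<noteq> 0\<close> unfolding B by simp
  ultimately show ?thesis using that by blast
qed

text \<open>
  A monic polynomial keeps its degree modulo 2, so one of positive degree does not become a unit there.
\<close>

lemma even_if_in_monic_ideal_mod_2:
  fixes F :: "int poly"
  assumes F: "lead_coeff F = 1" "degree F > 0" and eq: "of_int r = F * A + 2 * B"
  shows "even r"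
proof -
  obtain Q R where B: "B = F * Q + R" and R: "R = 0 \<or> degree R < degree F"
    using monic_division[OF F(1)] .
  have *: "F * (A + 2 * Q) = of_int r - 2 * R" using eq unfolding B by (simp add: algebra_simps)
  have "A + 2 * Q = 0"
  proof (rule ccontr)
    assume ne: "A + 2 * Q \<noteq> 0"
    have "F \<noteq> 0" using F by auto
    then have "degree (of_int r - 2 * R) \<ge> degree F"
      unfolding *[symmetric] using ne by (auto simp: degree_mult_eq)
    moreover have "degree (of_int r - 2 * R) < degree F"
      using R F(2) by (intro degree_diff_less) (auto simp: numeral_poly)
    ultimately show False by simp
  qed
  then have "of_int r = 2 * R" using * by simp
  then have "coeff (of_int r :: int poly) 0 = coeff (2 * R) 0" by simp
  then show ?thesis by (simp add: of_int_poly numeral_poly)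
qed

text \<open>
  The factor \<open>1 + 2R\<close> is invertible after localisation at 2. To avoid localising, note that the upper
  bound can be iterated to \<open>2\<^sup>e\<^sup>+\<^sup>1 \<in> 2\<^sup>k R' + I\<close> for every \<open>k\<close>; taking for \<open>k\<close> the exponent of 2 in the
  order \<open>l\<close> and multiplying by the odd part of \<open>l\<close> kills the right-hand side.
\<close>

lemma multiplicity_2_order:
  assumes dvd: "\<And>q. l dvd q \<longleftrightarrow> of_nat q \<in> mirror_ideal F" and "l > 0"
    and upper: "2 ^ Suc e * (1 + 2 * R) \<in> mirror_ideal F"
    and lower: "\<And>r :: nat. 2 ^ e * of_nat r \<in> mirror_ideal F \<Longrightarrow> even r"
  shows "multiplicity 2 l = Suc e"
proof -
  obtain r where l: "l = 2 ^ multiplicity 2 l * r" and r: "odd r"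
    using multiplicity_decompose'[of l 2] \<open>l > 0\<close> by auto
  define f where "f = multiplicity 2 l"
  have lI: "2 ^ f * of_nat r \<in> mirror_ideal F"
    using dvd[of l] l unfolding f_def by (metis dvd_refl of_nat_mult of_nat_numeral of_nat_power)
  have "\<not> f \<le> e"
  proof
    assume "f \<le> e"
    then have "(2 ^ e * of_nat r :: int poly) = 2 ^ f * of_nat r * 2 ^ (e - f)"
      by (simp add: mult.commute mult.left_commute flip: power_add)
    then show False using mirror_ideal_mult[OF lI] lower r by metis
  qed
  moreover have "f \<le> Suc e"
  proof -
    \<comment> \<open>Successive powers of \<open>- 2R\<close> replace 1 modulo the ideal.\<close>
    have "\<exists>R. 2 ^ Suc e * (1 - 2 ^ k * R) \<in> mirror_ideal F" for k
    proof (induction k)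
      case 0
      show ?case by (rule exI[of _ 1], rule mirror_idealI[of _ _ 0 0]) simp
    next
      case (Suc k)
      then obtain R' where R': "2 ^ Suc e * (1 - 2 ^ k * R') \<in> mirror_ideal F" by blast
      have "2 ^ Suc e * (1 - 2 ^ Suc k * (- R * R'))
          = 2 ^ Suc e * (1 - 2 ^ k * R') + 2 ^ Suc e * (1 + 2 * R) * (2 ^ k * R')"
        by (simp add: algebra_simps)
      also have "\<dots> = 2 ^ Suc e * (1 - 2 ^ k * R') - 2 ^ Suc e * (1 + 2 * R) * (- (2 ^ k * R'))"
        by simp
      also have "\<dots> \<in> mirror_ideal F"
        by (intro mirror_ideal_diff R' mirror_ideal_mult upper)
      finally show ?case by blast
    qed
    then obtain R' where R': "2 ^ Suc e * (1 - 2 ^ f * R') \<in> mirror_ideal F" by blast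
    have "2 ^ Suc e * (1 - 2 ^ f * R') * of_nat r - 2 ^ f * of_nat r * (- (2 ^ Suc e * R')) \<in> mirror_ideal F"
      by (intro mirror_ideal_diff mirror_ideal_mult R' lI)
    also have "2 ^ Suc e * (1 - 2 ^ f * R') * of_nat r - 2 ^ f * of_nat r * (- (2 ^ Suc e * R'))
        = of_nat (2 ^ Suc e * r)" by (simp add: algebra_simps)
    finally have "l dvd 2 ^ Suc e * r" using dvd by blast
    then have "2 ^ f dvd 2 ^ Suc e * r" using l unfolding f_def by (metis dvd_mult_left)
    then have "2 ^ f dvd (2 :: nat) ^ Suc e"
      using r by (simp add: coprime_dvd_mult_left_iff del: power_Suc)
    then show ?thesis by (simp add: dvd_power_iff_le del: power_Suc)
  qed
  ultimately show ?thesis unfolding f_def by simp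
qed

section \<open>Bounds for the exponent of 2\<close>

text \<open>
  Modulo \<open>F\<close> the reflection of \<open>F\<close> is \<open>\<plusminus> 2 S\<close> up to a multiple of 4, where \<open>S = cheb_S d\<close> is invertible
  modulo \<open>F\<close> because \<open>S\<^sup>2 (2 - X) \<equiv> 1\<close>.
\<close>

lemma even_grid_upper:
  fixes d :: nat
  defines "F \<equiv> cheb_S (Suc d) - cheb_S d"
  shows "\<exists>R. 2 * (1 + 2 * R) \<in> mirror_ideal F"
proof -
  define s :: "int poly" where "s = (- 1) ^ d"
  have s: "s * s = 1" unfolding s_def by (simp flip: power_add)
  obtain G where G: "mirror F = s * (F + 2 * cheb_S d) + 4 * G"
    using mirror_cheb_S_diff_mod unfolding F_def s_def by blast
  have S: "cheb_S d ^ 2 * (2 - X) = 1 + F * (X * cheb_S d - cheb_S d - cheb_S (Suc d))"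
    using cheb_S_norm[of d] unfolding F_def by Groebner_Basis.algebra
  have "2 * (1 + 2 * (s * G * cheb_S d * (2 - X)))
     = F * (- cheb_S d * (2 - X) - 2 * (X * cheb_S d - cheb_S d - cheb_S (Suc d))) + mirror F * (s * cheb_S d * (2 - X))"
    using S s G by Groebner_Basis.algebra
  then show ?thesis using mirror_idealI by blast
qed

lemma even_grid_lower:
  fixes d :: nat
  defines "F \<equiv> cheb_S (Suc d) - cheb_S d"
  assumes "d > 0" and r: "of_int r \<in> mirror_ideal F"
  shows "even r"
proof -
  obtain G where G: "mirror F = (- 1) ^ d * (F + 2 * cheb_S d) + 4 * G"
    using mirror_cheb_S_diff_mod unfolding F_def by blast
  obtain A B where "of_int r = F * A + mirror F * B" using r by (rule mirror_idealE)
  then have "of_int r = F * (A + (- 1) ^ d * B) + 2 * (((- 1) ^ d * cheb_S d + 2 * G) * B)"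
    unfolding G by (simp add: algebra_simps)
  with cheb_S_diff_monic[of d] show ?thesis
    using even_if_in_monic_ideal_mod_2 \<open>d > 0\<close> unfolding F_def by metis
qed

text \<open>
  With \<open>F = cheb_C m\<close>, \<open>S = cheb_S m\<close> and \<open>T = cheb_C (m - 1)\<close>, the angle formulas give \<open>S T \<equiv> 2\<close> and
  \<open>T\<^sup>2 \<equiv> 4 - X\<^sup>2\<close> modulo \<open>F\<close>. The ideal contains \<open>2\<^sup>a\<^sup>+\<^sup>2 E\<close> with \<open>E = u S + 2 Z + 4 K\<close>, hence also
  \<open>2\<^sup>a\<^sup>+\<^sup>2 T E \<equiv> 2\<^sup>a\<^sup>+\<^sup>3 (u + T Z + 2 T K)\<close>. Since \<open>(T Z)\<^sup>2 \<equiv> (4 - X\<^sup>2) Z\<^sup>2 \<equiv> X\<^sup>2 Z\<^sup>2 \<equiv> 0\<close> modulo 2 and \<open>F\<close>, multiplying by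
  \<open>u - T Z\<close> leaves an odd number plus a multiple of 2.
\<close>

lemma odd_grid_upper:
  assumes "odd k"
  shows "\<exists>R. 2 ^ (a + 3) * (1 + 2 * R) \<in> mirror_ideal (cheb_C (2 ^ a * k))"
proof -
  define m where "m = 2 ^ a * k"
  obtain j where j: "m = Suc j" using assms unfolding m_def
    by (metis mult_is_0 not0_implies_Suc odd_pos power_not_zero less_numeral_extra(3) zero_neq_numeral)
  obtain s u Z K where u: "odd u"
    and D: "mirror (cheb_C m) = s * cheb_C m + 2 ^ (a + 2) * (of_int u * cheb_S m + 2 * Z + 4 * K)"
    and Z: "if a = 0 then Z = 0 else \<exists>W. X ^ 2 * Z = cheb_C m + 2 * W"
    using mirror_cheb_C_dyadic[OF assms] unfolding m_def by blast
  define F where "F = cheb_C m"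
  define T where "T = cheb_C j"
  have F: "F = X * cheb_S m - 2 * cheb_S j" unfolding F_def j cheb_C_def by (simp add: algebra_simps)
  have T: "T = 2 * cheb_S m - X * cheb_S j" unfolding T_def j cheb_C_def by simp
  have N: "cheb_S m ^ 2 + cheb_S j ^ 2 - X * cheb_S j * cheb_S m = 1" using cheb_S_norm[of j] by (simp add: j)
  have ST: "cheb_S m * T = 2 + F * cheb_S j"
    using N unfolding F T by Groebner_Basis.algebra
  define V where "V = X * cheb_S m + 2 * cheb_S j - X ^ 2 * cheb_S j"
  have T2: "T ^ 2 = 4 - X ^ 2 + F * V"
    using N unfolding F T V_def by Groebner_Basis.algebra
  obtain w where "u ^ 2 = 1 + 2 * w" using u by (metis add.commute even_power oddE)
  then have w: "of_int u ^ 2 = (1 + 2 * of_int w :: int poly)"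
    by (metis of_int_1 of_int_add of_int_mult of_int_numeral of_int_power)
  \<comment> \<open>\<open>X\<^sup>2 Z\<^sup>2\<close> is divisible by \<open>X\<^sup>2 Z\<close>, which vanishes modulo 2 and \<open>F\<close>.\<close>
  obtain Y Y' where Y: "X ^ 2 * Z ^ 2 = F * Y + 2 * Y'"
  proof (cases "a = 0")
    case True
    then show ?thesis using that[of 0 0] Z by simp
  next
    case False
    then obtain W where "X ^ 2 * Z = F + 2 * W" using Z F_def by auto
    then have "X ^ 2 * Z ^ 2 = F * Z + 2 * (W * Z)" by Groebner_Basis.algebra
    then show ?thesis using that by blast
  qed
  \<comment> \<open>The multiplier is the conjugate of \<open>u + T Z\<close>; \<open>C\<close> collects the multiples of \<open>F\<close>.\<close>
  define U where "U = of_int u - T * Z"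
  define R where "R = of_int w - 2 * Z ^ 2 + Y' + T * K * U"
  define C where "C = - U * of_int u * cheb_S j + 2 * V * Z ^ 2 - 2 * Y"
  have main: "T * U * (of_int u * cheb_S m + 2 * Z + 4 * K) = 2 * (1 + 2 * R) - F * C"
    using ST T2 w Y unfolding R_def C_def U_def by Groebner_Basis.algebra
  define P :: "int poly" where "P = 2 ^ (a + 2)"
  have "2 ^ (a + 3) * (1 + 2 * R) = P * (2 * (1 + 2 * R))" by (simp add: P_def power_add)
  also have "\<dots> = F * (P * C - s * T * U) + mirror F * (T * U)"
    using main D unfolding F_def[symmetric] P_def[symmetric] by Groebner_Basis.algebra
  finally show ?thesis unfolding F_def m_def using mirror_idealI by blast
qed

text \<open>
  The reflection of \<open>F = cheb_C m\<close> is \<open>\<plusminus> F + 2\<^sup>a\<^sup>+\<^sup>2 E\<close>, and since \<open>F\<close> is monic the power of 2 can be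
  cancelled: \<open>r\<close> lies in the ideal generated by \<open>F\<close> and \<open>E\<close>. Modulo 2 both are multiples of \<open>cheb_S m\<close>,
  which is not constant because \<open>m > 1\<close>.
\<close>

lemma odd_grid_lower:
  assumes "odd k" "2 ^ a * k > 1" and r: "2 ^ (a + 2) * of_int r \<in> mirror_ideal (cheb_C (2 ^ a * k))"
  shows "even r"
proof -
  define m where "m = 2 ^ a * k"
  obtain j where j: "m = Suc j" "j > 0" using assms(2) unfolding m_def by (metis Suc_lessE zero_less_Suc One_nat_def)
  obtain s u Z K where u: "odd u"
    and D: "mirror (cheb_C m) = s * cheb_C m + 2 ^ (a + 2) * (of_int u * cheb_S m + 2 * Z + 4 * K)"
    using mirror_cheb_C_dyadic[OF assms(1)] unfolding m_def by blast
  obtain A B where "2 ^ (a + 2) * of_int r = cheb_C m * A + mirror (cheb_C m) * B"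
    using r unfolding m_def by (rule mirror_idealE)
  then have "cheb_C m * (A + s * B)
      = of_int (2 ^ (a + 2)) * (of_int r - (of_int u * cheb_S m + 2 * Z + 4 * K) * B)"
    unfolding D by (simp add: algebra_simps)
  moreover have "lead_coeff (cheb_C m) = 1" using cheb_C_monic j by simp
  ultimately obtain Q where "of_int r - (of_int u * cheb_S m + 2 * Z + 4 * K) * B = cheb_C m * Q"
    using monic_cancel_scalar by (metis power_not_zero zero_neq_numeral)
  moreover have "cheb_C m = X * cheb_S m - 2 * cheb_S j" unfolding j cheb_C_def by (simp add: algebra_simps)
  ultimately have "of_int r = cheb_S m * (X * Q + of_int u * B) + 2 * ((Z + 2 * K) * B - cheb_S j * Q)"
    by Groebner_Basis.algebra
  then show ?thesis using even_if_in_monic_ideal_mod_2 cheb_S_monic j by metis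
qed

section \<open>Coprimality and removal of common factors\<close>

text \<open>
  A nonzero combination \<open>h\<close> of least degree divides all other combinations up to a scalar, by
  pseudo-division; hence a root of \<open>h\<close> would be a common root of \<open>f\<close> and \<open>g\<close>, and \<open>h\<close> is a constant.
\<close>

lemma int_combination_if_no_common_root:
  fixes f g :: "int poly"
  assumes "f \<noteq> 0"
    and no_root: "\<And>z :: complex. poly (of_int_poly f) z = 0 \<Longrightarrow> poly (of_int_poly g) z \<noteq> 0"
  shows "\<exists>c A B. c \<noteq> 0 \<and> of_int c = f * A + g * B"
proof -
  define J where "J = {f * A + g * B | A B. True}"
  have J: "f * A + g * B \<in> J" for A B by (auto simp: J_def)
  have "f \<in> J" "g \<in> J" using J[of 1 0] J[of 0 1] by simp_all
  define h where "h = arg_min degree (\<lambda>p. p \<in> J \<and> p \<noteq> 0)"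
  have h: "h \<in> J" "h \<noteq> 0" and min: "\<And>p. p \<in> J \<Longrightarrow> p \<noteq> 0 \<Longrightarrow> degree h \<le> degree p"
    using arg_min_nat_lemma[of "\<lambda>p. p \<in> J \<and> p \<noteq> 0" f degree] \<open>f \<in> J\<close> \<open>f \<noteq> 0\<close>
    unfolding h_def by auto
  obtain A B where AB: "h = f * A + g * B" using h(1) by (auto simp: J_def)
  have vanish: "poly (of_int_poly p) z = 0" if p: "p \<in> J" and z: "poly (of_int_poly h) z = 0" for p and z :: complex
  proof -
    obtain q r where qr: "pseudo_divmod p h = (q, r)" by fastforce
    define c where "c = lead_coeff h ^ (Suc (degree p) - degree h)"
    have eq: "smult c p = h * q + r" and r: "r = 0 \<or> degree r < degree h"
      using pseudo_divmod[OF h(2) qr] unfolding c_def by auto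
    obtain A' B' where "p = f * A' + g * B'" using p by (auto simp: J_def)
    then have "r = f * (smult c A' - A * q) + g * (smult c B' - B * q)"
      using eq AB by (simp add: algebra_simps smult_add_right)
    then have "r \<in> J" using J by metis
    then have "r = 0" using min r by fastforce
    then have "of_int_poly (smult c p) = (of_int_poly (h * q) :: complex poly)" using eq by simp
    then have "of_int c * poly (of_int_poly p) z = poly (of_int_poly h) z * poly (of_int_poly q) z"
      by (metis of_int_hom.map_poly_hom_smult of_int_poly_hom.hom_mult poly_mult poly_smult)
    moreover have "c \<noteq> 0" using h(2) unfolding c_def by simp
    ultimately show ?thesis using z by simp
  qed
  have "degree h = 0"
  proof (rule ccontr)
    assume "degree h \<noteq> 0"
    then have "\<not> constant (poly (of_int_poly h :: complex poly))"
      by (simp add: constant_degree)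
    then obtain z :: complex where "poly (of_int_poly h) z = 0"
      using fundamental_theorem_of_algebra by blast
    then show False using vanish no_root \<open>f \<in> J\<close> \<open>g \<in> J\<close> by blast
  qed
  then obtain c where "h = [:c:]" by (rule degree_eq_zeroE)
  then show ?thesis using h(2) AB by (intro exI[of _ c] exI[of _ A] exI[of _ B]) (simp add: of_int_poly)
qed

lemma eval_cheb_S_Suc_Suc:
  fixes z :: "'a :: {comm_ring_1,ring_char_0}"
  shows "poly (of_int_poly (cheb_S (Suc (Suc k)))) z
    = z * poly (of_int_poly (cheb_S (Suc k))) z - poly (of_int_poly (cheb_S k)) z"
  by (simp add: hom_distribs X_def)

text \<open>
  For \<open>\<bar>z\<bar> > 2\<close> the recurrence forces strictly growing absolute values, so that all roots of the
  polynomials lie in the disc of radius 2.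
\<close>

lemma cheb_S_no_root_outside:
  fixes z :: complex
  assumes "norm z > 2"
  shows "norm (poly (of_int_poly (cheb_S k)) z) < norm (poly (of_int_poly (cheb_S (Suc k))) z)"
proof (induction k)
  case (Suc k)
  define a b where "a = poly (of_int_poly (cheb_S k)) z" and "b = poly (of_int_poly (cheb_S (Suc k))) z"
  have "norm a < norm b" using Suc by (simp add: a_def b_def)
  have "2 * norm b \<le> norm z * norm b" using assms by (intro mult_right_mono) auto
  also have "\<dots> - norm a \<le> norm (z * b - a)"
    using norm_triangle_ineq2[of "z * b" a] by (simp add: norm_mult)
  finally show ?case using \<open>norm a < norm b\<close> unfolding eval_cheb_S_Suc_Suc by (simp add: a_def b_def)
qed simp

lemma eval_cheb_S_2: "poly (of_int_poly (cheb_S k)) (2 :: complex) = of_nat k"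
  by (induction k rule: cheb_S.induct) (auto simp del: cheb_S.simps(3) simp: eval_cheb_S_Suc_Suc algebra_simps)

text \<open>
  A common root \<open>z\<close> would have both \<open>z\<close> and \<open>4 - z\<close> in the closed disc of radius 2 around 0. The only such
  point is \<open>z = 2\<close>, where the value is \<open>N\<close>.
\<close>

lemma cheb_S_mirror_coprime_over_rationals:
  assumes "N > 0"
  shows "\<exists>c A B. c \<noteq> 0 \<and> of_int c = cheb_S N * A + mirror (cheb_S N) * B"
proof (rule int_combination_if_no_common_root)
  show "cheb_S N \<noteq> 0" using cheb_S_monic(2)[of "N - 1"] assms by auto
next
  fix z :: complex
  assume z: "poly (of_int_poly (cheb_S N)) z = 0"
  have bound: "norm w \<le> 2" if "poly (of_int_poly (cheb_S N)) w = 0" for w :: complex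
  proof (rule ccontr)
    assume "\<not> norm w \<le> 2"
    then have "norm (poly (of_int_poly (cheb_S (N - 1))) w) < norm (poly (of_int_poly (cheb_S N)) w)"
      using cheb_S_no_root_outside[of w "N - 1"] assms by simp
    with that show False by simp
  qed
  show "poly (of_int_poly (mirror (cheb_S N))) z \<noteq> 0"
  proof
    assume "poly (of_int_poly (mirror (cheb_S N))) z = 0"
    then have "norm (4 - z) \<le> 2" by (intro bound) (simp add: poly_mirror)
    moreover have "norm z \<le> 2" using bound z .
    ultimately have "Re z = 2"
      using complex_Re_le_cmod[of z] complex_Re_le_cmod[of "4 - z"] by simp
    moreover from this \<open>norm z \<le> 2\<close> have "Im z = 0"
      using power_mono[of "norm z" 2 2] by (simp add: cmod_power2)
    ultimately have "z = 2" by (simp add: complex_eq_iff)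
    then show False using z assms by (simp add: eval_cheb_S_2)
  qed
qed

text \<open>
  The factor \<open>P\<close> is coprime over the rationals to the reflection of \<open>P F\<close>, so it can be split off
  from the coefficients, and the factor \<open>h\<close> is a unit modulo \<open>F\<close>.
\<close>

lemma cancel_common_factor:
  assumes "N > 0" and S: "cheb_S N = P * F" and P: "lead_coeff P = 1"
    and I: "of_int q * (P * h) * mirror (P * h) \<in> mirror_ideal (cheb_S N)"
    and h: "h * k = 1 + F * l"
  shows "of_int q \<in> mirror_ideal F"
proof -
  obtain c C D where "c \<noteq> 0" and c: "of_int c = cheb_S N * C + mirror (cheb_S N) * D"
    using cheb_S_mirror_coprime_over_rationals[OF \<open>N > 0\<close>] by blast
  \<comment> \<open>By the combination \<open>c\<close>, \<open>P\<close> divides an integer multiple of \<open>B\<close>, and the integer can be dropped since \<open>P\<close> is monic.\<close>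
  have cancel: "\<exists>B'. B = P * B'" if eq: "P * A = mirror (cheb_S N) * B" for A B
  proof -
    have "P * (F * C * B + D * A) = of_int c * B"
      using c eq unfolding S by (simp add: algebra_simps)
    then show ?thesis using monic_cancel_scalar[OF P] \<open>c \<noteq> 0\<close> by metis
  qed
  obtain A B where AB: "of_int q * (P * h) * mirror (P * h) = cheb_S N * A + mirror (cheb_S N) * B"
    using I by (rule mirror_idealE)
  have "P * (of_int q * h * mirror (P * h) - F * A) = mirror (cheb_S N) * B"
    using AB S by (simp add: algebra_simps)
  then obtain B' where B: "B = P * B'" using cancel by blast
  have "mirror (of_int q * (P * h) * mirror (P * h)) = mirror (cheb_S N * A + mirror (cheb_S N) * B)"
    using AB by simp
  then have "P * (of_int q * h * mirror (P * h) - F * mirror B) = mirror (cheb_S N) * mirror A"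
    by (simp add: S algebra_simps)
  then obtain A' where "mirror A = P * A'" using cancel by blast
  then have A: "A = mirror P * mirror A'" by (metis mirror_mirror mirror_simps(8))
  have "P \<noteq> 0" using P by auto
  then have "mirror P \<noteq> 0" by (metis mirror_mirror mirror_simps(1))
  have "(P * mirror P) * (of_int q * h * mirror h) = (P * mirror P) * (F * mirror A' + mirror F * B')"
    using AB unfolding A B S by (simp add: algebra_simps)
  then have "of_int q * h * mirror h = F * mirror A' + mirror F * B'"
    using \<open>P \<noteq> 0\<close> \<open>mirror P \<noteq> 0\<close> by simp
  moreover have "mirror h * mirror k = 1 + mirror F * mirror l" using arg_cong[OF h, of mirror] by simp
  ultimately have "of_int q = F * (mirror A' * k * mirror k - of_int q * l * (1 + mirror F * mirror l))
     + mirror F * (B' * k * mirror k - of_int q * mirror l)"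
    using h by Groebner_Basis.algebra
  then show ?thesis by (rule mirror_idealI)
qed

lemma mirror_ideal_common_factor:
  assumes "of_int q \<in> mirror_ideal F"
  shows "of_int q * (P * h) * mirror (P * h) \<in> mirror_ideal (P * F)"
proof -
  obtain A B where "of_int q = F * A + mirror F * B" using assms by (rule mirror_idealE)
  then have "of_int q * (P * h) * mirror (P * h)
      = P * F * (A * h * mirror (P * h)) + mirror (P * F) * (B * P * h * mirror h)"
    by (simp add: algebra_simps)
  then show ?thesis by (rule mirror_idealI)
qed

section \<open>Solutions on the grid as polynomial congruences\<close>

text \<open>
  The grid is indexed from 1 to \<open>n\<close>, with the sink represented by zero values on the surrounding frame.
\<close>

definition grid_solution :: "nat \<Rightarrow> int \<Rightarrow> (nat \<Rightarrow> nat \<Rightarrow> int) \<Rightarrow> bool" where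
  "grid_solution n q u \<longleftrightarrow>
    (\<forall>i. u 0 i = 0 \<and> u (Suc n) i = 0 \<and> u i 0 = 0 \<and> u i (Suc n) = 0) \<and>
    (\<forall>i\<in>{1..n}. \<forall>j\<in>{1..n}.
      4 * u i j = q + (u (i - 1) j + u (i + 1) j) + (u i (j - 1) + u i (j + 1)))"

lemma cheb_S_summation_by_parts:
  assumes "f 0 = 0" "f (Suc n) = 0"
  shows "X * (\<Sum>i=1..n. f i * cheb_S i) = (\<Sum>i=1..n. (f (i - 1) + f (i + 1)) * cheb_S i) + f n * cheb_S (Suc n)"
proof -
  have "X * (\<Sum>i=1..m. f i * cheb_S i)
      = (\<Sum>i=1..m. (f (i - 1) + f (i + 1)) * cheb_S i) + f m * cheb_S (Suc m) - f (Suc m) * cheb_S m" for m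
    by (induction m) (simp_all add: assms(1) algebra_simps)
  from this[of n] show ?thesis using assms(2) by simp
qed

text \<open>
  Pairing the grid equation with \<open>cheb_S i (x) * cheb_S j (4 - x)\<close>: these products satisfy the homogeneous
  equation because \<open>x + (4 - x) = 4\<close>, and vanish on two sides of the frame. What remains is the
  contribution of the other two sides, a combination of \<open>cheb_S (n + 1)\<close> and its reflection.
\<close>

lemma grid_solution_imp_mirror_ideal:
  assumes u: "grid_solution n q u"
  shows "of_int q * (\<Sum>k=1..n. cheb_S k) * mirror (\<Sum>k=1..n. cheb_S k) \<in> mirror_ideal (cheb_S (Suc n))"
proof -
  define r where "r i = (\<Sum>j=1..n. of_int (u i j) * mirror (cheb_S j))" for i
  define t where "t i = (\<Sum>j=1..n. of_int (u i (j - 1) + u i (j + 1)) * mirror (cheb_S j))" for i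
  define g where "g = (\<Sum>k=1..n. cheb_S k)"
  have bd: "u 0 i = 0" "u (Suc n) i = 0" "u i 0 = 0" "u i (Suc n) = 0" for i
    using u by (auto simp: grid_solution_def)
  have r_t: "(4 - X) * r i = t i + of_int (u i n) * mirror (cheb_S (Suc n))" for i
    using arg_cong[OF cheb_S_summation_by_parts[of "\<lambda>j. of_int (u i j)" n], of mirror]
    by (simp add: bd r_def t_def)
  have r: "4 * r i = of_int q * mirror g + (r (i - 1) + r (i + 1)) + t i" if i: "i \<in> {1..n}" for i
  proof -
    have "4 * r i = (\<Sum>j=1..n. of_int (4 * u i j) * mirror (cheb_S j))"
      by (simp add: r_def sum_distrib_left mult.assoc)
    also have "\<dots> = (\<Sum>j=1..n. of_int (q + (u (i - 1) j + u (i + 1) j) + (u i (j - 1) + u i (j + 1))) * mirror (cheb_S j))"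
      using u i by (intro sum.cong) (simp_all add: grid_solution_def)
    also have "\<dots> = of_int q * mirror g + (r (i - 1) + r (i + 1)) + t i"
      by (simp add: g_def r_def t_def sum.distrib sum_distrib_left algebra_simps)
    finally show ?thesis .
  qed
  have "X * (\<Sum>i=1..n. r i * cheb_S i) = (\<Sum>i=1..n. (r (i - 1) + r (i + 1)) * cheb_S i) + r n * cheb_S (Suc n)"
    by (rule cheb_S_summation_by_parts) (simp_all add: r_def bd)
  moreover have "(4 - X) * (\<Sum>i=1..n. r i * cheb_S i)
      = (\<Sum>i=1..n. t i * cheb_S i) + mirror (cheb_S (Suc n)) * (\<Sum>i=1..n. of_int (u i n) * cheb_S i)"
    by (simp add: sum_distrib_left mult.assoc[symmetric] r_t distrib_right sum.distrib)
      (simp add: mult.commute mult.left_commute)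
  moreover have "4 * (\<Sum>i=1..n. r i * cheb_S i) = of_int q * g * mirror g
      + (\<Sum>i=1..n. (r (i - 1) + r (i + 1)) * cheb_S i) + (\<Sum>i=1..n. t i * cheb_S i)"
  proof -
    have "4 * (\<Sum>i=1..n. r i * cheb_S i) = (\<Sum>i=1..n. (of_int q * mirror g + (r (i - 1) + r (i + 1)) + t i) * cheb_S i)"
      unfolding sum_distrib_left mult.assoc[symmetric] using r by (intro sum.cong) auto
    also have "\<dots> = (\<Sum>i=1..n. (of_int q * mirror g) * cheb_S i)
      + (\<Sum>i=1..n. (r (i - 1) + r (i + 1)) * cheb_S i) + (\<Sum>i=1..n. t i * cheb_S i)"
      by (simp only: distrib_right[of "_ + _"] distrib_right[of "_ * _"] sum.distrib)
    also have "(\<Sum>i=1..n. (of_int q * mirror g) * cheb_S i) = of_int q * g * mirror g"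
      unfolding sum_distrib_left[symmetric] g_def[symmetric] by (simp add: mult_ac)
    finally show ?thesis .
  qed
  ultimately have "of_int q * g * mirror g
      = cheb_S (Suc n) * r n + mirror (cheb_S (Suc n)) * (\<Sum>i=1..n. of_int (u i n) * cheb_S i)"
    by (simp add: algebra_simps del: cheb_S.simps)
  then show ?thesis unfolding g_def by (rule mirror_idealI)
qed

definition path_adjacency :: "nat \<Rightarrow> (nat \<Rightarrow> int) \<Rightarrow> nat \<Rightarrow> int" where
  "path_adjacency n f i = (if 1 \<le> i \<and> i \<le> n then f (i - 1) + f (i + 1) else 0)"

text \<open>
  The value of the polynomial \<open>p\<close> at the adjacency matrix of the path, applied to the first unit vector.
  Equivalently, these are the coordinates of \<open>p\<close> modulo \<open>cheb_S (n + 1)\<close> in the basis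
  \<open>cheb_S 1, \<dots>, cheb_S n\<close>.
\<close>

definition coord :: "nat \<Rightarrow> int poly \<Rightarrow> nat \<Rightarrow> int" where
  "coord n p = fold_coeffs (\<lambda>a f i. (if i = 1 then a else 0) + path_adjacency n f i) p (\<lambda>_. 0)"

lemma coord_0 [simp]: "coord n 0 i = 0"
  by (simp add: coord_def)

lemma coord_pCons: "coord n (pCons a p) i = (if i = 1 then a else 0) + path_adjacency n (coord n p) i"
  by (cases "a = 0 \<and> p = 0") (auto simp: coord_def path_adjacency_def)

lemma coord_add [simp]: "coord n (p + r) i = coord n p i + coord n r i"
  by (induction p r arbitrary: i rule: poly_induct2) (auto simp: coord_pCons path_adjacency_def)

lemma coord_of_int [simp]: "coord n (of_int c * p) i = c * coord n p i"
  by (induction p arbitrary: i) (auto simp: of_int_poly coord_pCons path_adjacency_def algebra_simps)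

lemma coord_minus [simp]: "coord n (- p) i = - coord n p i"
  using coord_of_int[of n "- 1" p i] by simp

lemma coord_diff [simp]: "coord n (p - r) i = coord n p i - coord n r i"
  using coord_add[of n p "- r" i] by simp

lemma coord_sum [simp]: "coord n (sum h J) i = (\<Sum>j\<in>J. coord n (h j) i)"
  by (induction J rule: infinite_finite_induct) auto

lemma coord_X: "coord n (X * p) i = path_adjacency n (coord n p) i"
  by (simp add: X_def coord_pCons)

lemma coord_boundary:
  assumes "n \<ge> 1"
  shows "coord n p 0 = 0" "coord n p (Suc n) = 0"
  using assms by (cases p; auto simp: coord_pCons path_adjacency_def)+

lemma coord_cheb_S:
  assumes "n \<ge> 1" "k \<le> Suc n"
  shows "coord n (cheb_S k) i = (if i = k \<and> 1 \<le> k \<and> k \<le> n then 1 else 0)"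
  using assms(2)
proof (induction k arbitrary: i rule: cheb_S.induct)
  case 2
  have "coord n [:1:] i = (if i = 1 then 1 else 0)"
    by (auto simp: coord_pCons path_adjacency_def)
  then show ?case using assms(1) by (auto simp: one_pCons)
qed (auto simp: coord_X path_adjacency_def)

lemma coord_cheb_S_multiple:
  assumes "n \<ge> 1"
  shows "coord n (cheb_S (Suc n) * A) i = 0"
proof (induction A arbitrary: i)
  case (pCons a A)
  have "pCons a A = of_int a + X * A" by (simp add: X_def of_int_poly)
  then have "cheb_S (Suc n) * pCons a A = of_int a * cheb_S (Suc n) + X * (cheb_S (Suc n) * A)"
    by (simp only: algebra_simps)
  then have "coord n (cheb_S (Suc n) * pCons a A) i
      = a * coord n (cheb_S (Suc n)) i + path_adjacency n (coord n (cheb_S (Suc n) * A)) i"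
    by (simp only: coord_add coord_of_int coord_X)
  then show ?case using assms pCons.IH by (simp add: coord_cheb_S path_adjacency_def del: cheb_S.simps)
qed simp

lemma cheb_S_partial_sums: "(\<Sum>k<Suc (Suc j). cheb_S k) + (\<Sum>k<j. cheb_S k) = X * (\<Sum>k<Suc j. cheb_S k) + 1"
  by (induction j) (simp_all add: algebra_simps)

text \<open>
  The columns \<open>w j\<close> of a solution are sought in \<open>\<int>[x] / (cheb_S (n + 1))\<close>. The grid equation prescribes
  \<open>w (j + 1)\<close> from the two preceding columns, so \<open>w 0 = 0\<close> and \<open>w 1 = B\<close> determine everything, with the
  closed form used for \<open>w\<close> below. The assumption on \<open>q\<close> says exactly that for a suitable \<open>B\<close> the column
  \<open>w (n + 1)\<close> vanishes.
\<close>

lemma mirror_ideal_imp_grid_solution: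
  assumes n: "n \<ge> 1"
    and I: "of_int q * (\<Sum>k=1..n. cheb_S k) * mirror (\<Sum>k=1..n. cheb_S k) \<in> mirror_ideal (cheb_S (Suc n))"
  shows "\<exists>u. grid_solution n q u"
proof -
  define g where "g = (\<Sum>k=1..n. cheb_S k)"
  obtain A B where AB: "of_int q * g * mirror g = cheb_S (Suc n) * A + mirror (cheb_S (Suc n)) * B"
    using I unfolding g_def by (rule mirror_idealE)
  define w where "w j = mirror (cheb_S j) * B - of_int q * (g * mirror (\<Sum>k<j. cheb_S k))" for j
  have rec: "w (Suc (Suc j)) + w j = of_int 4 * w (Suc j) - X * w (Suc j) - of_int q * g" for j
  proof -
    have "mirror (\<Sum>k<Suc (Suc j). cheb_S k) + mirror (\<Sum>k<j. cheb_S k) = (4 - X) * mirror (\<Sum>k<Suc j. cheb_S k) + 1"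
      using arg_cong[OF cheb_S_partial_sums[of j], of mirror] by (simp only: mirror_simps)
    moreover have "mirror (cheb_S (Suc (Suc j))) = (4 - X) * mirror (cheb_S (Suc j)) - mirror (cheb_S j)" by simp
    ultimately show ?thesis unfolding w_def of_int_numeral by Groebner_Basis.algebra
  qed
  have "(\<Sum>k<Suc n. cheb_S k) = g"
    unfolding g_def lessThan_Suc_atMost atMost_atLeast0 by (simp add: sum.atLeast_Suc_atMost)
  then have w_end: "w (Suc n) = - (cheb_S (Suc n) * A)"
    using AB unfolding w_def by (simp add: algebra_simps del: cheb_S.simps)
  have g: "coord n g i = 1" if "i \<in> {1..n}" for i
  proof -
    have "coord n g i = (\<Sum>k=1..n. if k = i then 1 else 0)"
      unfolding g_def coord_sum using n by (intro sum.cong) (auto simp: coord_cheb_S)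
    also have "\<dots> = 1" using that by simp
    finally show ?thesis .
  qed
  have "grid_solution n q (\<lambda>i j. coord n (w j) i)"
    unfolding grid_solution_def
  proof (intro conjI allI ballI)
    fix i
    show "coord n (w i) 0 = 0" "coord n (w i) (Suc n) = 0" using coord_boundary n by auto
    show "coord n (w 0) i = 0" by (simp add: w_def)
    show "coord n (w (Suc n)) i = 0" unfolding w_end coord_minus using coord_cheb_S_multiple n by simp
  next
    fix i j assume i: "i \<in> {1..n}" and j: "j \<in> {1..n}"
    then obtain j' where j': "j = Suc j'" by (cases j) auto
    have "coord n (w (j + 1)) i + coord n (w (j - 1)) i
        = 4 * coord n (w j) i - path_adjacency n (coord n (w j)) i - q"
      using arg_cong[OF rec[of j'], of "\<lambda>p. coord n p i"] g[OF i]
      unfolding coord_add coord_diff coord_of_int coord_X by (simp add: j')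
    then show "4 * coord n (w j) i = q + (coord n (w j) (i - 1) + coord n (w j) (i + 1))
        + (coord n (w (j - 1)) i + coord n (w (j + 1)) i)"
      using i by (simp add: path_adjacency_def)
  qed
  then show ?thesis by blast
qed

section \<open>From the sandpile group to the grid\<close>

lemma sum_D_mat:
  assumes "i < n"
  shows "(\<Sum>k<n. D_mat n $$ (i, k) * f k)
    = 2 * f i - (if i = 0 then 0 else f (i - 1)) - (if Suc i = n then 0 else f (Suc i))"
proof -
  have "(\<Sum>k<n. D_mat n $$ (i, k) * f k)
      = (\<Sum>k<n. (if k = i then 2 * f i else 0) - (if k = i - 1 then (if i = 0 then 0 else f (i - 1)) else 0)
          - (if k = Suc i then f (Suc i) else 0))"
    using assms by (intro sum.cong) (auto simp: D_mat_def)
  then show ?thesis using assms by (auto simp: sum_subtractf)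
qed

lemma row_major_less:
  fixes i j n :: nat
  assumes "i < n" "j < n"
  shows "i * n + j < n * n"
proof -
  have "i * n + j < Suc i * n" using assms(2) by simp
  also have "\<dots> \<le> n * n" using assms(1) by (intro mult_right_mono) auto
  finally show ?thesis .
qed

lemma reduced_laplacian_entry:
  assumes "i < n" "j < n" "k < n" "l < n"
  shows "reduced_laplacian n $$ (i * n + j, k * n + l) =
    (if j = l then D_mat n $$ (i, k) else 0) + (if i = k then D_mat n $$ (j, l) else 0)"
  using assms by (simp add: row_major_less reduced_laplacian_def kronecker_mat_def D_mat_def)

lemma reduced_laplacian_mult_vec:
  assumes x: "x \<in> carrier_vec (n\<^sup>2)" and i: "i < n" and j: "j < n"
  shows "(reduced_laplacian n *\<^sub>v x) $ (i * n + j)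
    = (\<Sum>k<n. D_mat n $$ (i, k) * x $ (k * n + j)) + (\<Sum>l<n. D_mat n $$ (j, l) * x $ (i * n + l))"
proof -
  have bound: "i * n + j < n * n" using i j by (rule row_major_less)
  have block: "(\<Sum>p\<in>{k * n..<k * n + n}. f p) = (\<Sum>l<n. f (k * n + l))" for f :: "nat \<Rightarrow> int" and k
    by (simp add: sum.atLeastLessThan_shift_0[of f] atLeast0LessThan)
  have "(reduced_laplacian n *\<^sub>v x) $ (i * n + j)
      = (\<Sum>p<n * n. reduced_laplacian n $$ (i * n + j, p) * x $ p)"
    using x bound reduced_laplacian_carrier[of n]
    by (auto simp: scalar_prod_def power2_eq_square atLeast0LessThan intro!: sum.cong)
  also have "\<dots> = (\<Sum>k<n. \<Sum>p\<in>{k * n..<k * n + n}. reduced_laplacian n $$ (i * n + j, p) * x $ p)"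
    by (rule sum.nat_group[symmetric])
  also have "\<dots> = (\<Sum>k<n. \<Sum>l<n. reduced_laplacian n $$ (i * n + j, k * n + l) * x $ (k * n + l))"
    by (simp only: block)
  also have "\<dots> = (\<Sum>k<n. \<Sum>l<n. (if l = j then D_mat n $$ (i, k) * x $ (k * n + j) else 0)
      + (if k = i then D_mat n $$ (j, l) * x $ (i * n + l) else 0))"
    using i j by (intro sum.cong refl) (auto simp: reduced_laplacian_entry distrib_right)
  also have "\<dots> = (\<Sum>k<n. D_mat n $$ (i, k) * x $ (k * n + j)) + (\<Sum>l<n. D_mat n $$ (j, l) * x $ (i * n + l))"
    using i j by (simp add: sum.distrib) (subst sum.swap, simp)
  finally show ?thesis .
qed

lemma constant_in_laplacian_image_iff:
  "vec (n\<^sup>2) (\<lambda>_. q) \<in> laplacian_image n \<longleftrightarrow> (\<exists>u. grid_solution n q u)"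
proof
  assume "vec (n\<^sup>2) (\<lambda>_. q) \<in> laplacian_image n"
  then obtain x where x: "x \<in> carrier_vec (n\<^sup>2)" and eq: "reduced_laplacian n *\<^sub>v x = vec (n\<^sup>2) (\<lambda>_. q)"
    by (auto simp: laplacian_image_def)
  define u where "u i j = (if i \<in> {1..n} \<and> j \<in> {1..n} then x $ ((i - 1) * n + (j - 1)) else 0)" for i j
  have "grid_solution n q u"
    unfolding grid_solution_def
  proof (intro conjI allI ballI)
    fix i j assume "i \<in> {1..n}" "j \<in> {1..n}"
    then obtain i' j' where ij: "i = Suc i'" "i' < n" "j = Suc j'" "j' < n"
      by (cases i; cases j) auto
    have "i' * n + j' < n\<^sup>2" using ij by (metis row_major_less power2_eq_square)
    then have "q = (reduced_laplacian n *\<^sub>v x) $ (i' * n + j')" unfolding eq by simp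
    also have "\<dots> = 4 * u i j - (u (i - 1) j + u (i + 1) j) - (u i (j - 1) + u i (j + 1))"
      unfolding reduced_laplacian_mult_vec[OF x \<open>i' < n\<close> \<open>j' < n\<close>] sum_D_mat[OF \<open>i' < n\<close>] sum_D_mat[OF \<open>j' < n\<close>]
      using ij by (auto simp: u_def)
    finally show "4 * u i j = q + (u (i - 1) j + u (i + 1) j) + (u i (j - 1) + u i (j + 1))" by simp
  qed (auto simp: u_def)
  then show "\<exists>u. grid_solution n q u" by blast
next
  assume "\<exists>u. grid_solution n q u"
  then obtain u where u: "grid_solution n q u" by blast
  define x where "x = vec (n\<^sup>2) (\<lambda>p. u (Suc (p div n)) (Suc (p mod n)))"
  have x: "x \<in> carrier_vec (n\<^sup>2)" by (simp add: x_def)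
  have x_u: "x $ (i * n + j) = u (Suc i) (Suc j)" if "i < n" "j < n" for i j
  proof -
    have "i * n + j < n\<^sup>2" using that by (metis row_major_less power2_eq_square)
    then show ?thesis using that by (simp add: x_def)
  qed
  have "reduced_laplacian n *\<^sub>v x = vec (n\<^sup>2) (\<lambda>_. q)"
  proof (rule eq_vecI)
    fix p assume "p < dim_vec (vec (n\<^sup>2) (\<lambda>_. q))"
    then have p: "p < n * n" by (simp add: power2_eq_square)
    define i j where "i = p div n" and "j = p mod n"
    have "n > 0" using p by (cases n) auto
    then have ij: "i < n" "j < n" "p = i * n + j"
      using p unfolding i_def j_def by (auto simp: less_mult_imp_div_less)
    have "(\<Sum>k<n. D_mat n $$ (i, k) * x $ (k * n + j)) = (\<Sum>k<n. D_mat n $$ (i, k) * u (Suc k) (Suc j))"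
      "(\<Sum>l<n. D_mat n $$ (j, l) * x $ (i * n + l)) = (\<Sum>l<n. D_mat n $$ (j, l) * u (Suc i) (Suc l))"
      using ij x_u by auto
    then have "(reduced_laplacian n *\<^sub>v x) $ p =
        4 * u (Suc i) (Suc j) - (u i (Suc j) + u (Suc (Suc i)) (Suc j)) - (u (Suc i) j + u (Suc i) (Suc (Suc j)))"
      unfolding ij(3) reduced_laplacian_mult_vec[OF x ij(1,2)] sum_D_mat[OF ij(1)] sum_D_mat[OF ij(2)]
      using u by (auto simp: grid_solution_def)
    also have "\<dots> = q"
      using u ij(1,2) unfolding grid_solution_def by (auto dest!: bspec[of _ _ "Suc i"] bspec[of _ _ "Suc j"])
    finally show "(reduced_laplacian n *\<^sub>v x) $ p = vec (n\<^sup>2) (\<lambda>_. q) $ p"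
      using p by (simp add: power2_eq_square)
  qed (use reduced_laplacian_carrier in auto)
  then show "vec (n\<^sup>2) (\<lambda>_. q) \<in> laplacian_image n"
    using x unfolding laplacian_image_def by (metis imageI)
qed

lemma L_dvd_iff: "L n dvd q \<longleftrightarrow> vec (n\<^sup>2) (\<lambda>_. int q) \<in> laplacian_image n"
proof -
  let ?G = "monoid_vec TYPE(int) (n\<^sup>2)"
  let ?H = "laplacian_image n"
  interpret G: comm_group ?G by (rule comm_group_vec)
  interpret K: comm_group "sandpile_group n" by (rule comm_group_sandpile_group)
  have "(\<lambda>x. reduced_laplacian n *\<^sub>v x) \<in> hom ?G ?G"
    by (rule homI)
      (simp_all only: monoid_vec_simps mult_mat_vec_carrier[OF reduced_laplacian_carrier]
        mult_add_distrib_mat_vec[OF reduced_laplacian_carrier])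
  then interpret h: group_hom ?G ?G "\<lambda>x. reduced_laplacian n *\<^sub>v x"
    by (intro group_hom.intro group_hom_axioms.intro G.group_axioms)
  have H: "subgroup ?H ?G"
    using h.img_is_subgroup by (simp only: laplacian_image_def monoid_vec_simps)
  then interpret N: normal ?H ?G by (rule G.subgroup_imp_normal)
  interpret p: group_hom ?G "sandpile_group n" "sandpile_class n"
    unfolding sandpile_class_def[abs_def] sandpile_group_def
    by (intro group_hom.intro group_hom_axioms.intro G.group_axioms N.factorgroup_is_group N.r_coset_hom_Mod)
  have ones: "ones_vec (n\<^sup>2) \<in> carrier ?G" by (simp add: ones_vec_def monoid_vec_simps)
  have pow: "ones_vec (n\<^sup>2) [^]\<^bsub>?G\<^esub> q = vec (n\<^sup>2) (\<lambda>_. int q)" for q :: nat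
    by (induction q) (auto simp: monoid_vec_simps ones_vec_def)
  have "L n dvd q \<longleftrightarrow> sandpile_class n (ones_vec (n\<^sup>2)) [^]\<^bsub>sandpile_group n\<^esub> q = \<one>\<^bsub>sandpile_group n\<^esub>"
    unfolding L_def using K.pow_eq_id[OF p.hom_closed[OF ones]] by simp
  also have "\<dots> \<longleftrightarrow> sandpile_class n (vec (n\<^sup>2) (\<lambda>_. int q)) = ?H"
    using p.hom_nat_pow[OF ones, of q] by (simp add: pow sandpile_group_def)
  also have "\<dots> \<longleftrightarrow> vec (n\<^sup>2) (\<lambda>_. int q) \<in> ?H"
    unfolding sandpile_class_def
    using G.coset_join1[OF _ _ H] G.coset_join2[OF _ H] N.subset
    by (metis monoid_vec_simps(2) vec_carrier)
  finally show ?thesis .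
qed

section \<open>The exponent of 2 in the order\<close>

text \<open>
  The order is the additive order of \<open>g(x) g(4 - x)\<close> in \<open>\<int>[x] / (p(x), p(4 - x))\<close> for
  \<open>p = cheb_S (n + 1)\<close> and \<open>g = cheb_S 1 + \<dots> + cheb_S n\<close>. The all-ones vector is symmetric, which shows as a
  common factor \<open>P\<close> of \<open>p\<close> and \<open>g\<close>; removing it leaves the order of 1.
\<close>

lemma L_dvd_iff_mirror_ideal:
  assumes "n \<ge> 1" and S: "cheb_S (Suc n) = P * F" and g: "(\<Sum>k=1..n. cheb_S k) = P * h"
    and P: "lead_coeff P = 1" and h: "h * k = 1 + F * l"
  shows "L n dvd q \<longleftrightarrow> of_nat q \<in> mirror_ideal F"
proof -
  have "L n dvd q \<longleftrightarrow> of_int (int q) * (P * h) * mirror (P * h) \<in> mirror_ideal (cheb_S (Suc n))"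
    unfolding L_dvd_iff constant_in_laplacian_image_iff g[symmetric]
    using grid_solution_imp_mirror_ideal[of n "int q"] mirror_ideal_imp_grid_solution[OF \<open>n \<ge> 1\<close>, of "int q"]
    by blast
  also have "\<dots> \<longleftrightarrow> of_int (int q) \<in> mirror_ideal F"
    using cancel_common_factor[OF zero_less_Suc S P _ h] mirror_ideal_common_factor S by metis
  finally show ?thesis by simp
qed

text \<open>
  The group is finite: a nonzero integer lies in the ideal generated by \<open>cheb_S (n + 1)\<close> and its reflection.
\<close>

lemma L_pos:
  assumes "n \<ge> 1"
  shows "L n > 0"
proof -
  obtain c A B where "c \<noteq> 0" and c: "of_int c = cheb_S (Suc n) * A + mirror (cheb_S (Suc n)) * B"
    using cheb_S_mirror_coprime_over_rationals by blast
  then have "of_int c \<in> mirror_ideal (cheb_S (Suc n))" by (intro mirror_idealI)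
  then have "of_int c * (of_int (sgn c) * (\<Sum>k=1..n. cheb_S k) * mirror (\<Sum>k=1..n. cheb_S k)) \<in> mirror_ideal (cheb_S (Suc n))"
    by (rule mirror_ideal_mult)
  moreover have "c * sgn c = int (nat \<bar>c\<bar>)" by (simp add: sgn_if)
  then have "of_int c * of_int (sgn c) = (of_int (int (nat \<bar>c\<bar>)) :: int poly)"
    by (simp only: flip: of_int_mult)
  ultimately have "of_int (int (nat \<bar>c\<bar>)) * (\<Sum>k=1..n. cheb_S k) * mirror (\<Sum>k=1..n. cheb_S k) \<in> mirror_ideal (cheb_S (Suc n))"
    by (simp only: mult.assoc[symmetric])
  then have "L n dvd nat \<bar>c\<bar>"
    unfolding L_dvd_iff constant_in_laplacian_image_iff using mirror_ideal_imp_grid_solution assms by blast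
  then show ?thesis using \<open>c \<noteq> 0\<close> by (intro gr0I) auto
qed

theorem theorem1:
  fixes n :: nat
  assumes "n \<ge> 1"
  shows "multiplicity 2 (L n) =
    (if n = 1 then 2 else if even n then 1 else multiplicity 2 (n + 1) + 2)"
proof (cases "even n")
  case True
  then obtain d where n: "n = 2 * d" by blast
  with assms have "d > 0" by simp
  \<comment> \<open>\<open>F\<close> is \<open>cos ((n + 1) \<theta> / 2) / cos (\<theta> / 2)\<close>; its roots are the eigenvalues of the symmetric eigenvectors of the path.\<close>
  define F where "F = cheb_S (Suc d) - cheb_S d"
  have norm: "cheb_S d * (cheb_S d * (2 - X)) = 1 + F * (X * cheb_S d - cheb_S d - cheb_S (Suc d))"
    using cheb_S_norm[of d] unfolding F_def by Groebner_Basis.algebra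
  have monic: "lead_coeff (cheb_S (Suc d) + cheb_S d) = 1"
    by (rule cheb_S_diff_monic)
  have dvd: "L n dvd q \<longleftrightarrow> of_nat q \<in> mirror_ideal F" for q
    using L_dvd_iff_mirror_ideal[OF assms _ _ monic norm] cheb_S_double_plus_1[of d] sum_cheb_S_double[of d]
    unfolding n F_def by (simp add: mult.commute)
  obtain R where "2 * (1 + 2 * R) \<in> mirror_ideal F" using even_grid_upper unfolding F_def by blast
  then have "multiplicity 2 (L n) = Suc 0"
    using even_grid_lower[OF \<open>d > 0\<close>, folded F_def]
    by (intro multiplicity_2_order[OF dvd L_pos[OF assms]]) (auto, metis even_of_nat of_int_of_nat_eq)
  then show ?thesis using True by auto
next
  case False
  then obtain j where n: "n = Suc (2 * j)" by (metis oddE Suc_eq_plus1)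
  define m where "m = Suc j"
  \<comment> \<open>Here \<open>cheb_S (2m) = cheb_S m * cheb_C m\<close>, and the unit \<open>h\<close> is inverted by \<open>X \<mapsto> - X\<close>, up to sign.\<close>
  have norm: "(cheb_S m + cheb_S j) * (cheb_S m - cheb_S j) = 1 + cheb_C m * cheb_S j"
    using cheb_S_norm[of j] unfolding m_def cheb_C_Suc cheb_S.simps by Groebner_Basis.algebra
  have dvd: "L n dvd q \<longleftrightarrow> of_nat q \<in> mirror_ideal (cheb_C m)" for q
    using L_dvd_iff_mirror_ideal[OF assms _ _ _ norm, of "cheb_S m"] cheb_S_double[of m]
      sum_cheb_S_double_plus_1[of j] cheb_S_monic(2)[of j]
    unfolding n m_def by simp
  note order = multiplicity_2_order[OF dvd L_pos[OF assms]]
  show ?thesis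
  proof (cases "j = 0")
    case True
    then have F: "cheb_C m = X" by (simp add: m_def cheb_C_simps)
    \<comment> \<open>\<open>x + (4 - x) = 4\<close>\<close>
    have "2 ^ Suc 1 * (1 + 2 * 0) \<in> mirror_ideal (cheb_C m)"
      unfolding F by (rule mirror_idealI[of _ _ 1 1]) simp
    moreover have "even r" if r: "2 ^ 1 * of_nat r \<in> mirror_ideal (cheb_C m)" for r :: nat
    proof -
      obtain A B where "2 ^ 1 * of_nat r = X * A + mirror X * B"
        using r unfolding F by (rule mirror_idealE)
      then have "poly (2 ^ 1 * of_nat r) 0 = poly (X * A + (4 - X) * B) 0" by simp
      then have "2 * int r = 4 * poly B 0" by (simp add: X_def)
      then show ?thesis by presburger
    qed
    ultimately have "multiplicity 2 (L n) = Suc 1" by (rule order)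
    then show ?thesis using n True by simp
  next
    case False
    define a where "a = multiplicity 2 m"
    obtain k where m: "m = 2 ^ a * k" and k: "odd k"
      using multiplicity_decompose'[of m 2] unfolding a_def m_def by auto
    obtain R where "2 ^ Suc (a + 2) * (1 + 2 * R) \<in> mirror_ideal (cheb_C m)"
      using odd_grid_upper[OF k, of a] unfolding m[symmetric] by (auto simp: numeral_3_eq_3)
    moreover have "even r" if "2 ^ (a + 2) * of_nat r \<in> mirror_ideal (cheb_C m)" for r :: nat
      using odd_grid_lower[OF k, of a "int r"] that m False unfolding m_def by simp
    ultimately have "multiplicity 2 (L n) = Suc (a + 2)" by (rule order)
    moreover have "multiplicity 2 (n + 1) = Suc a"
    proof -
      have "n + 1 = 2 * m" by (simp add: n m_def)
      then show ?thesis unfolding a_def by (simp only:) (rule multiplicity_times_same, auto simp: m_def)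
    qed
    ultimately show ?thesis using n False by simp
  qed
qed

end
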